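(* (i) There exist infinitely many bipartite fan-planar (simple) graphs $G$ such that, with $n$ the number of vertices of $G$, $G$ has exactly $4n-16$ edges. (ii) There exist infinitely many bipartite fan-planar multigraphs $G$ such that, with $n$ the number of vertices of $G$, $G$ has exactly $4n-12$ edges.
   Context: A topological drawing places vertices at distinct points and edges as Jordan arcs between their endpoints, such that no edge passes through a vertex other than its endpoints, no two adjacent edges cross, no edge crosses itself, no two edges meet tangentially, and any two edges cross at most once. A multigraph may have parallel edges (no loops), but in its drawing there are no homotopic edges: each region (bounded or unbounded) delimited by two parallel edges contains at least one vertex in its interior. A drawing is fan-planar if for every edge $e$, all edges crossing $e$ have a common endpoint $v$, and moreover this common endpoint lies on the same side of $e$ for all of them (equivalently, $e$ is not crossed by two independent edges, nor by two adjacent edges from different directions). A (multi)graph is fan-planar if it admits a fan-planar drawing. *)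

theory Defs
  imports "HOL-Complex_Analysis.Winding_Numbers"
begin

section \<open>Multigraphs\<close>

record ('v, 'e) multigraph =
  verts :: "'v set"
  edges :: "'e set"
  ends :: "'e \<Rightarrow> 'v set"

definition is_multigraph :: "('v, 'e) multigraph \<Rightarrow> bool" where
  "is_multigraph G \<longleftrightarrow> finite (verts G) \<and> finite (edges G) \<and>
     (\<forall>e\<in>edges G. ends G e \<subseteq> verts G \<and> card (ends G e) = 2)"

definition is_simple_graph :: "('v, 'e) multigraph \<Rightarrow> bool" where
  "is_simple_graph G \<longleftrightarrow> is_multigraph G \<and> inj_on (ends G) (edges G)"

definition bipartite :: "('v, 'e) multigraph \<Rightarrow> bool" where
  "bipartite G \<longleftrightarrow> (\<exists>A B. A \<union> B = verts G \<and> A \<inter> B = {} \<and>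
     (\<forall>e\<in>edges G. \<exists>a\<in>A. \<exists>b\<in>B. ends G e = {a, b}))"

definition isomorphic :: "('v, 'e) multigraph \<Rightarrow> ('w, 'f) multigraph \<Rightarrow> bool" where
  "isomorphic G H \<longleftrightarrow> (\<exists>\<alpha> \<beta>. bij_betw \<alpha> (verts G) (verts H) \<and>
     bij_betw \<beta> (edges G) (edges H) \<and> (\<forall>e\<in>edges G. ends H (\<beta> e) = \<alpha> ` ends G e))"


section \<open>Crossings of arcs in the plane\<close>

text \<open>A chart at \<open>p\<close> in which the curves \<open>g\<close> and \<open>h\<close> become the horizontal and the vertical
  diameter of the unit disc. Two arcs that meet at \<open>p\<close> without such a chart
  touch at \<open>p\<close> (or overlap, or end there) instead of crossing.\<close>

definition cross_chart ::
  "complex set \<Rightarrow> (complex \<Rightarrow> complex) \<Rightarrow> (real \<Rightarrow> complex) \<Rightarrow> (real \<Rightarrow> complex) \<Rightarrow> complex \<Rightarrow> bool"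
where
  "cross_chart U \<phi> g h p \<longleftrightarrow>
     open U \<and> p \<in> U \<and> (\<exists>\<psi>. homeomorphism U (ball 0 1) \<phi> \<psi>) \<and> \<phi> p = 0 \<and>
     \<phi> ` (U \<inter> path_image g) = {z \<in> ball 0 1. Im z = 0} \<and>
     \<phi> ` (U \<inter> path_image h) = {z \<in> ball 0 1. Re z = 0}"

definition crosses_at :: "(real \<Rightarrow> complex) \<Rightarrow> (real \<Rightarrow> complex) \<Rightarrow> complex \<Rightarrow> bool" where
  "crosses_at g h p \<longleftrightarrow> (\<exists>U \<phi>. cross_chart U \<phi> g h p)"

text \<open>Only used for homeomorphisms \<open>\<phi>\<close> between open sets; there the winding number is \<open>1\<close> or
  \<open>-1\<close> and does not depend on \<open>r\<close>.\<close>

definition orientation_preserving_at :: "complex set \<Rightarrow> (complex \<Rightarrow> complex) \<Rightarrow> complex \<Rightarrow> bool" where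
  "orientation_preserving_at U \<phi> p \<longleftrightarrow>
     (\<exists>r>0. cball p r \<subseteq> U \<and> winding_number (\<phi> \<circ> circlepath p r) (\<phi> p) = 1)"

text \<open>The curve \<open>h\<close>, followed in its direction, crosses the directed curve \<open>g\<close> at \<open>p\<close> coming from
  the right-hand side of \<open>g\<close>: in an oriented chart \<open>g\<close> runs in the positive real
  and \<open>h\<close> in the positive imaginary direction.\<close>

definition crosses_from_right :: "(real \<Rightarrow> complex) \<Rightarrow> (real \<Rightarrow> complex) \<Rightarrow> complex \<Rightarrow> bool" where
  "crosses_from_right g h p \<longleftrightarrow>
     (\<exists>U \<phi> s t. cross_chart U \<phi> g h p \<and> orientation_preserving_at U \<phi> p \<and>
        s \<in> {0<..<1} \<and> g s = p \<and> (\<forall>\<^sub>F u in at_right s. 0 < Re (\<phi> (g u))) \<and>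
        t \<in> {0<..<1} \<and> h t = p \<and> (\<forall>\<^sub>F u in at_right t. 0 < Im (\<phi> (h u))))"

definition crosses_from_left :: "(real \<Rightarrow> complex) \<Rightarrow> (real \<Rightarrow> complex) \<Rightarrow> complex \<Rightarrow> bool" where
  "crosses_from_left g h p \<longleftrightarrow> crosses_from_right (reversepath g) h p"


section \<open>Topological and fan-planar drawings\<close>

text \<open>A drawing is given by the positions \<open>pos\<close> of the vertices and the curves \<open>\<gamma>\<close> of the edges.
  The direction of the parametrisation of \<open>\<gamma> e\<close> carries no meaning.\<close>

definition crossings ::
  "('v, 'e) multigraph \<Rightarrow> ('v \<Rightarrow> complex) \<Rightarrow> ('e \<Rightarrow> real \<Rightarrow> complex) \<Rightarrow> 'e \<Rightarrow> 'e \<Rightarrow> complex set"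
where
  "crossings G pos \<gamma> e f = path_image (\<gamma> e) \<inter> path_image (\<gamma> f) - pos ` verts G"

definition topological_drawing ::
  "('v, 'e) multigraph \<Rightarrow> ('v \<Rightarrow> complex) \<Rightarrow> ('e \<Rightarrow> real \<Rightarrow> complex) \<Rightarrow> bool"
where
  "topological_drawing G pos \<gamma> \<longleftrightarrow>
     inj_on pos (verts G) \<and>
     (\<forall>e\<in>edges G. arc (\<gamma> e) \<and> {pathstart (\<gamma> e), pathfinish (\<gamma> e)} = pos ` ends G e \<and>
        path_image (\<gamma> e) \<inter> pos ` verts G = pos ` ends G e) \<and>
     (\<forall>e\<in>edges G. \<forall>f\<in>edges G. e \<noteq> f \<longrightarrow>
        (ends G e \<inter> ends G f \<noteq> {} \<longrightarrow> crossings G pos \<gamma> e f = {}) \<and>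
        (\<forall>p\<in>crossings G pos \<gamma> e f. crosses_at (\<gamma> e) (\<gamma> f) p) \<and>
        (\<forall>p\<in>crossings G pos \<gamma> e f. \<forall>q\<in>crossings G pos \<gamma> e f. p = q))"

text \<open>In a topological drawing two parallel edges form a Jordan curve; the components of its
  complement are the two regions they delimit.\<close>

definition no_homotopic_edges ::
  "('v, 'e) multigraph \<Rightarrow> ('v \<Rightarrow> complex) \<Rightarrow> ('e \<Rightarrow> real \<Rightarrow> complex) \<Rightarrow> bool"
where
  "no_homotopic_edges G pos \<gamma> \<longleftrightarrow>
     (\<forall>e\<in>edges G. \<forall>f\<in>edges G. e \<noteq> f \<and> ends G e = ends G f \<longrightarrow>
        (\<forall>C\<in>components (- (path_image (\<gamma> e) \<union> path_image (\<gamma> f))). \<exists>v\<in>verts G. pos v \<in> C))"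

definition directed_from :: "complex \<Rightarrow> (real \<Rightarrow> complex) \<Rightarrow> real \<Rightarrow> complex" where
  "directed_from x g = (if pathstart g = x then g else reversepath g)"

text \<open>The common endpoint \<open>v\<close> of the edges crossing \<open>e\<close> lies on the same side of \<open>e\<close> for all of
  them if, followed from \<open>v\<close>, they all cross \<open>e\<close> from the same side.\<close>

definition fan_planar_drawing ::
  "('v, 'e) multigraph \<Rightarrow> ('v \<Rightarrow> complex) \<Rightarrow> ('e \<Rightarrow> real \<Rightarrow> complex) \<Rightarrow> bool"
where
  "fan_planar_drawing G pos \<gamma> \<longleftrightarrow>
     topological_drawing G pos \<gamma> \<and> no_homotopic_edges G pos \<gamma> \<and>
     (\<forall>e\<in>edges G. \<exists>v.
        (\<forall>f\<in>edges G. f \<noteq> e \<and> crossings G pos \<gamma> e f \<noteq> {} \<longrightarrow> v \<in> ends G f) \<and>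
        ((\<forall>f\<in>edges G. f \<noteq> e \<longrightarrow> (\<forall>p\<in>crossings G pos \<gamma> e f.
            crosses_from_right (\<gamma> e) (directed_from (pos v) (\<gamma> f)) p)) \<or>
         (\<forall>f\<in>edges G. f \<noteq> e \<longrightarrow> (\<forall>p\<in>crossings G pos \<gamma> e f.
            crosses_from_left (\<gamma> e) (directed_from (pos v) (\<gamma> f)) p))))"

definition fan_planar :: "('v, 'e) multigraph \<Rightarrow> bool" where
  "fan_planar G \<longleftrightarrow> (\<exists>pos \<gamma>. fan_planar_drawing G pos \<gamma>)"

end

theory Submission
  imports Defs
begin

text \<open>Place four hubs at the points \<open>\<plusminus>1 \<plusminus> \<i>\<close> and \<open>k + 1\<close> vertices on the segment from \<open>-\<i>\<close> to \<open>\<i>\<close> of the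
  imaginary axis, including its end points, and join every hub to every axis vertex by a straight segment. On
  either side of the axis the edges of the lower hub cross only edges of the upper hub and
  vice versa, always with the same orientation, so this drawing of \<open>K\<close> with parts of size \<open>4\<close> and
  \<open>n - 4\<close> is fan-planar and has \<open>4n - 16\<close> edges.

  For each hub, a further edge to the farther end point of the segment fits into the outer face if it is
  bent around the other hub of its side. Together with the straight parallel edge it bounds a
  triangle around that hub, and the only crossings of the four new edges are one between
  the two on the left and one between the two on the right. This gives \<open>4n - 12\<close> edges.

  All curves are polygonal and cross away from their bends, so real-linear maps serve as charts.\<close>

section \<open>Crossings of locally straight arcs\<close>

text \<open>Multiplication by \<open>a\<close> turns the circle into one full turn of radius
  \<open>norm a * r\<close> that starts at the angle \<open>Arg a\<close>. With respect to the
  angle, \<open>1 / w\<close> pulls back to the constant \<open>\<i>\<close>.\<close>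

lemma winding_number_rotated_circle:
  assumes "a \<noteq> 0" "r > 0"
  shows "winding_number (\<lambda>t. a * circlepath 0 r t) 0 = 1"
proof -
  define s where "s = Arg a"
  let ?c = "part_circlepath 0 (norm a * r) s (s + 2 * pi)"
  have "a = of_real (norm a) * exp (\<i> * of_real s)"
    unfolding s_def by (metis Arg_eq assms(1))
  then have eq: "(\<lambda>t. a * circlepath 0 r t) = ?c"
    by (auto simp: circlepath_def part_circlepath_def linepath_def fun_eq_iff exp_add algebra_simps)
  have "((\<lambda>w. 1 / w) has_contour_integral 2 * pi * \<i>) ?c"
  proof -
    have "((\<lambda>t. \<i>) has_integral (2 * pi) *\<^sub>R \<i>) {s..s + 2 * pi}"
      using has_integral_const_real[of "\<i>" s "s + 2 * pi"] by simp
    then show ?thesis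
      by (subst has_contour_integral_part_circlepath_iff)
        (use assms in \<open>simp_all add: scaleR_conv_of_real\<close>)
  qed
  moreover have "winding_number ?c 0 = 1 / (2 * pi * \<i>) * contour_integral ?c (\<lambda>w. 1 / (w - 0))"
    by (rule winding_number_valid_path)
      (use assms in \<open>auto dest!: in_path_image_part_circlepath\<close>)
  ultimately show ?thesis
    using contour_integral_unique[of "\<lambda>w. 1 / w" "2 * pi * \<i>" ?c] by (simp add: eq)
qed

text \<open>Every real-linear map of the plane has the form \<open>a * z + b * cnj z\<close>, and
  its determinant is positive exactly if \<open>norm b < norm a\<close>. The conjugate part is then
  smaller than the distance of \<open>a * z\<close> from 0, so dropping it leaves the winding number
  unchanged.\<close>

lemma winding_number_ellipse:
  assumes "norm b < norm a" "r > 0"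
  shows "winding_number (\<lambda>t. a * circlepath 0 r t + b * cnj (circlepath 0 r t)) 0 = 1"
proof -
  have "winding_number (\<lambda>t. a * circlepath 0 r t + b * cnj (circlepath 0 r t)) 0
      = winding_number (\<lambda>t. a * circlepath 0 r t) 0"
  proof (rule winding_number_nearby_loops_eq)
    have c: "continuous_on {0..1} (circlepath 0 r)"
      using path_circlepath path_def by blast
    show "path (\<lambda>t. a * circlepath 0 r t)"
      "path (\<lambda>t. a * circlepath 0 r t + b * cnj (circlepath 0 r t))"
      unfolding path_def by (intro continuous_intros c)+
    show "pathfinish (\<lambda>t. a * circlepath 0 r t) = pathstart (\<lambda>t. a * circlepath 0 r t)"
      "pathfinish (\<lambda>t. a * circlepath 0 r t + b * cnj (circlepath 0 r t)) =
       pathstart (\<lambda>t. a * circlepath 0 r t + b * cnj (circlepath 0 r t))"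
      by (simp_all add: pathfinish_def pathstart_def circlepath)
    fix t :: real
    have "norm (circlepath 0 r t) = r"
      using assms by (simp add: circlepath norm_mult)
    then show "norm (a * circlepath 0 r t + b * cnj (circlepath 0 r t) - a * circlepath 0 r t)
        < norm (a * circlepath 0 r t - 0)"
      using assms by (simp add: norm_mult)
  qed
  also have "\<dots> = 1"
    using assms by (intro winding_number_rotated_circle) auto
  finally show ?thesis .
qed

section \<open>Linear charts at points where two arcs are straight\<close>

text \<open>\<open>d\<close> is the velocity in the given parametrisation. Only a window of interior
  parameters is described; that the curve does not come back to \<open>p\<close> follows later from
  injectivity of arcs.\<close>

definition locally_straight :: "(real \<Rightarrow> complex) \<Rightarrow> complex \<Rightarrow> complex \<Rightarrow> bool" where
  "locally_straight g p d \<longleftrightarrow> (\<exists>s \<eta>. 0 < \<eta> \<and> \<eta> \<le> s \<and> s + \<eta> \<le> 1 \<and>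
     (\<forall>u. \<bar>u - s\<bar> < \<eta> \<longrightarrow> g u = p + of_real (u - s) * d))"

lemma locally_straight_reversepath:
  assumes "locally_straight g p d"
  shows "locally_straight (reversepath g) p (- d)"
proof -
  obtain s \<eta> where *: "0 < \<eta>" "\<eta> \<le> s" "s + \<eta> \<le> 1"
    "\<And>u. \<bar>u - s\<bar> < \<eta> \<Longrightarrow> g u = p + of_real (u - s) * d"
    using assms unfolding locally_straight_def by blast
  have "reversepath g u = p + of_real (u - (1 - s)) * (- d)" if "\<bar>u - (1 - s)\<bar> < \<eta>" for u
    using *(4)[of "1 - u"] that by (simp add: reversepath_def abs_minus_commute algebra_simps)
  with * show ?thesis
    unfolding locally_straight_def by (intro exI[of _ "1 - s"] exI[of _ \<eta>]) auto
qed

lemma locally_straight_linepath: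
  assumes "0 < u" "u < 1"
  shows "locally_straight (linepath x y) (linepath x y u) (y - x)"
  unfolding locally_straight_def
  using assms by (intro exI[of _ u] exI[of _ "min u (1 - u)"])
    (auto simp: linepath_def scaleR_conv_of_real algebra_simps)

lemma locally_straight_joinpaths1:
  assumes "locally_straight g p d"
  shows "locally_straight (g +++ h) p (2 * d)"
proof -
  obtain s \<eta> where *: "0 < \<eta>" "\<eta> \<le> s" "s + \<eta> \<le> 1"
    "\<And>u. \<bar>u - s\<bar> < \<eta> \<Longrightarrow> g u = p + of_real (u - s) * d"
    using assms unfolding locally_straight_def by blast
  have "(g +++ h) u = p + of_real (u - s / 2) * (2 * d)" if "\<bar>u - s / 2\<bar> < \<eta> / 2" for u
  proof -
    have "\<bar>2 * u - s\<bar> < \<eta>"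
      using that by (simp add: abs_if split: if_splits)
    moreover have "u \<le> 1 / 2"
      using that *(3) by (simp add: abs_if split: if_splits)
    ultimately show ?thesis
      using *(4)[of "2 * u"] by (simp add: joinpaths_def algebra_simps)
  qed
  with * show ?thesis
    unfolding locally_straight_def by (intro exI[of _ "s / 2"] exI[of _ "\<eta> / 2"]) auto
qed

text \<open>An arc does not return to \<open>p\<close>, so a small enough ball around
  \<open>p\<close> sees only the straight piece.\<close>

lemma arc_locally_straightE:
  assumes "arc g" "locally_straight g p d"
  obtains s \<eta> \<delta> where "0 < \<eta>" "0 < \<delta>" "0 < s" "s < 1" "\<And>u. \<bar>u - s\<bar> < \<eta> \<Longrightarrow> u \<in> {0..1}"
    "\<And>u. \<bar>u - s\<bar> < \<eta> \<Longrightarrow> g u = p + of_real (u - s) * d"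
    "path_image g \<inter> ball p \<delta> \<subseteq> {p + of_real x * d | x. True}"
proof -
  obtain s \<eta> where *: "0 < \<eta>" "\<eta> \<le> s" "s + \<eta> \<le> 1"
    "\<And>u. \<bar>u - s\<bar> < \<eta> \<Longrightarrow> g u = p + of_real (u - s) * d"
    using assms unfolding locally_straight_def by blast
  \<comment> \<open>The part of the arc outside the window is compact and, by injectivity, misses
    \<open>p\<close>; so it has positive distance from \<open>p\<close>.\<close>
  define K where "K = g ` ({0..1} - ball s \<eta>)"
  have gs: "g s = p"
    using *(4)[of s] *(1) by simp
  have "compact K"
    unfolding K_def using arc_imp_path[OF assms(1)]
    by (intro compact_continuous_image compact_diff)
      (auto simp: path_def intro: continuous_on_subset)
  moreover have "p \<notin> K"
  proof
    assume "p \<in> K"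
    then obtain u where u: "u \<in> {0..1}" "u \<notin> ball s \<eta>" "g u = g s"
      unfolding K_def using gs by auto
    moreover have "s \<in> {0..1}" using * by auto
    ultimately have "u = s"
      using assms(1) unfolding arc_def inj_on_def by blast
    with u * show False by auto
  qed
  ultimately obtain \<delta> where \<delta>: "\<delta> > 0" "ball p \<delta> \<subseteq> - K"
    by (metis Compl_iff compact_imp_closed open_Compl open_contains_ball)
  show thesis
  proof
    show "path_image g \<inter> ball p \<delta> \<subseteq> {p + of_real x * d | x. True}"
    proof
      fix z assume z: "z \<in> path_image g \<inter> ball p \<delta>"
      then obtain u where u: "u \<in> {0..1}" "z = g u"
        by (auto simp: path_image_def)
      with z \<delta> have "u \<in> ball s \<eta>"
        unfolding K_def by blast
      then show "z \<in> {p + of_real x * d | x. True}"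
        using *(4)[of u] u by (auto simp: dist_real_def abs_minus_commute simp del: of_real_diff)
    qed
    show "u \<in> {0..1}" if "\<bar>u - s\<bar> < \<eta>" for u
      using that * by (auto simp: abs_if split: if_splits)
  qed (use * \<delta> in auto)
qed

text \<open>The chart is the affine map that sends \<open>p\<close> to 0 and the vectors
  \<open>\<epsilon> * d\<close> and \<open>\<epsilon> * d'\<close> to 1 and \<open>\<i>\<close>. The
  quantity \<open>Im (cnj d * d')\<close> is the determinant of \<open>d\<close> and
  \<open>d'\<close>, whose sign decides the orientation.\<close>

proposition crosses_from_right_if_locally_straight:
  assumes g: "arc g" "locally_straight g p d" and h: "arc h" "locally_straight h p d'"
    and pos: "0 < Im (cnj d * d')"
  shows "crosses_from_right g h p"
proof -
  obtain s \<eta> \<delta> where g': "0 < \<eta>" "0 < \<delta>" "0 < s" "s < 1" "\<And>u. \<bar>u - s\<bar> < \<eta> \<Longrightarrow> u \<in> {0..1}"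
    "\<And>u. \<bar>u - s\<bar> < \<eta> \<Longrightarrow> g u = p + of_real (u - s) * d"
    "path_image g \<inter> ball p \<delta> \<subseteq> {p + of_real x * d | x. True}"
    by (rule arc_locally_straightE[OF g]) (rule that)
  obtain s' \<eta>' \<delta>' where h': "0 < \<eta>'" "0 < \<delta>'" "0 < s'" "s' < 1"
    "\<And>u. \<bar>u - s'\<bar> < \<eta>' \<Longrightarrow> u \<in> {0..1}"
    "\<And>u. \<bar>u - s'\<bar> < \<eta>' \<Longrightarrow> h u = p + of_real (u - s') * d'"
    "path_image h \<inter> ball p \<delta>' \<subseteq> {p + of_real x * d' | x. True}"
    by (rule arc_locally_straightE[OF h]) (rule that)
  \<comment> \<open>The inverse chart maps the unit disc into the ball of radius
    \<open>\<epsilon> * M\<close> around \<open>p\<close>. The scale \<open>\<epsilon>\<close> is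
    chosen so that both arcs are straight in this ball and the parameters needed to fill the two
    diameters stay in the windows.\<close>
  define M where "M = norm d + norm d' + 1"
  have M: "M > 0" by (simp add: M_def add_nonneg_pos)
  define \<epsilon> where "\<epsilon> = min (min \<eta> \<eta>') (min \<delta> \<delta>' / M)"
  have \<epsilon>: "\<epsilon> > 0" "\<epsilon> \<le> \<eta>" "\<epsilon> \<le> \<eta>'" "\<epsilon> * M \<le> \<delta>" "\<epsilon> * M \<le> \<delta>'"
  proof -
    have "\<epsilon> * M \<le> min \<delta> \<delta>'"
      unfolding pos_le_divide_eq[OF M, symmetric] \<epsilon>_def by (rule min.cobounded2)
    then show "\<epsilon> * M \<le> \<delta>" "\<epsilon> * M \<le> \<delta>'" by auto
  qed (use g'(1,2) h'(1,2) M in \<open>auto simp: \<epsilon>_def\<close>)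
  define D where "D = Im (cnj d * d')"
  have D: "D > 0" using pos by (simp add: D_def)
  \<comment> \<open>Cramer's rule for the coordinates of \<open>z - p\<close> in the basis
    \<open>\<epsilon> * d\<close>, \<open>\<epsilon> * d'\<close>; \<open>\<psi>\<close> reassembles
    a point from its coordinates.\<close>
  define \<phi> where "\<phi> z = Complex (Im (cnj (z - p) * d') / (\<epsilon> * D)) (Im (cnj d * (z - p)) / (\<epsilon> * D))" for z
  define \<psi> where "\<psi> w = p + of_real \<epsilon> * (of_real (Re w) * d + of_real (Im w) * d')" for w
  define U where "U = \<phi> -` ball 0 1"
  have \<phi>\<psi>: "\<phi> (\<psi> w) = w" for w
  proof -
    have "Im (cnj (\<psi> w - p) * d') = \<epsilon> * D * Re w" "Im (cnj d * (\<psi> w - p)) = \<epsilon> * D * Im w"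
      by (simp_all add: \<psi>_def D_def algebra_simps)
    then show ?thesis
      using \<epsilon> D by (simp add: \<phi>_def complex_eq_iff)
  qed
  have \<psi>\<phi>: "\<psi> (\<phi> z) = z" for z
  proof -
    define X Y where "X = Im (cnj (z - p) * d')" and "Y = Im (cnj d * (z - p))"
    have "X * Re d + Y * Re d' = D * Re (z - p)" "X * Im d + Y * Im d' = D * Im (z - p)"
      by (simp_all add: D_def X_def Y_def algebra_simps)
    then have "Re (z - p) = (X * Re d + Y * Re d') / D" "Im (z - p) = (X * Im d + Y * Im d') / D"
      using D by simp_all
    moreover have "\<phi> z = Complex (X / (\<epsilon> * D)) (Y / (\<epsilon> * D))"
      by (simp only: \<phi>_def X_def Y_def)
    then have "Re (\<psi> (\<phi> z) - p) = (X * Re d + Y * Re d') / D"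
      "Im (\<psi> (\<phi> z) - p) = (X * Im d + Y * Im d') / D"
      using \<epsilon>(1) D by (simp_all add: \<psi>_def
          add_divide_distrib distrib_left)
    ultimately have "\<psi> (\<phi> z) - p = z - p"
      by (metis complex_eq_iff)
    then show ?thesis by simp
  qed
  have cont: "continuous_on S \<phi>" "continuous_on S \<psi>" for S
  proof -
    have "\<phi> = (\<lambda>z. of_real (Im (cnj (z - p) * d') / (\<epsilon> * D)) + \<i> * of_real (Im (cnj d * (z - p)) / (\<epsilon> * D)))"
      by (auto simp: \<phi>_def fun_eq_iff complex_eq_iff)
    then show "continuous_on S \<phi>"
      using \<epsilon> D by (simp only:) (intro continuous_intros, auto)
    show "continuous_on S \<psi>"
      unfolding \<psi>_def by (intro continuous_intros)
  qed
  have openU: "open U"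
    unfolding U_def using cont(1)[of UNIV] by (simp add: continuous_on_eq_continuous_within open_vimage)
  have \<phi>p: "\<phi> p = 0" by (simp add: \<phi>_def complex_eq_iff)
  then have pU: "p \<in> U" by (simp add: U_def)
  have hom: "homeomorphism U (ball 0 1) \<phi> \<psi>"
    by (rule homeomorphismI) (auto simp: cont U_def \<phi>\<psi> \<psi>\<phi>)
  have U_ball: "U \<subseteq> ball p \<delta> \<inter> ball p \<delta>'"
  proof
    fix z assume "z \<in> U"
    then have n: "norm (\<phi> z) < 1" by (simp add: U_def)
    define w where "w = \<phi> z"
    have "norm (z - p) = \<epsilon> * norm (of_real (Re w) * d + of_real (Im w) * d')"
      using \<psi>\<phi>[of z] \<epsilon> unfolding \<psi>_def w_def
      by (metis abs_of_pos add_diff_cancel_left' norm_mult norm_of_real)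
    also have "\<dots> \<le> \<epsilon> * (norm w * norm d + norm w * norm d')"
      using \<epsilon> abs_Re_le_cmod[of w] abs_Im_le_cmod[of w]
      by (intro mult_left_mono norm_triangle_le add_mono)
        (auto simp: norm_mult intro: mult_right_mono)
    also have "\<dots> \<le> \<epsilon> * (norm d + norm d')"
      using n \<epsilon> by (intro mult_left_mono add_mono) (auto simp: w_def intro: mult_left_le_one_le)
    also have "\<dots> < \<epsilon> * M"
      using \<epsilon> by (simp add: M_def)
    finally show "z \<in> ball p \<delta> \<inter> ball p \<delta>'"
      using \<epsilon> by (auto simp: dist_norm norm_minus_commute)
  qed
  have \<phi>d: "\<phi> (p + of_real x * d) = of_real (x / \<epsilon>)" for x
    using \<phi>\<psi>[of "of_real (x / \<epsilon>)"] \<epsilon> by (simp add: \<psi>_def flip: of_real_mult)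
  have \<phi>d': "\<phi> (p + of_real x * d') = \<i> * of_real (x / \<epsilon>)" for x
    using \<phi>\<psi>[of "\<i> * of_real (x / \<epsilon>)"] \<epsilon> by (simp add: \<psi>_def flip: of_real_mult)
  have img: "\<phi> ` (U \<inter> path_image g) = {z \<in> ball 0 1. Im z = 0}"
  proof (intro equalityI subsetI)
    fix w assume "w \<in> \<phi> ` (U \<inter> path_image g)"
    then obtain z where z: "z \<in> U" "z \<in> path_image g" "w = \<phi> z" by auto
    then obtain x where "z = p + of_real x * d" using U_ball g'(7) by auto
    then show "w \<in> {z \<in> ball 0 1. Im z = 0}"
      using z \<phi>d[of x] by (auto simp: U_def)
  next
    fix w :: complex assume w: "w \<in> {z \<in> ball 0 1. Im z = 0}"
    then have wr: "w = of_real (Re w)" by (simp add: complex_eq_iff)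
    then have "\<bar>Re w\<bar> < 1" using w by (metis (mono_tags) mem_Collect_eq mem_ball_0 norm_of_real)
    then have "\<bar>Re w\<bar> * \<epsilon> < 1 * \<epsilon>"
      using \<epsilon>(1) by (intro mult_strict_right_mono)
    then have "\<bar>Re w * \<epsilon>\<bar> < \<eta>"
      using \<epsilon>(2,3) unfolding abs_mult abs_of_pos[OF \<epsilon>(1)] by linarith
    then have u: "\<bar>(s + Re w * \<epsilon>) - s\<bar> < \<eta>" by simp
    \<comment> \<open>At this parameter \<open>g\<close> has moved from \<open>p\<close> by
      \<open>Re w\<close> times the basis vector \<open>\<epsilon> * d\<close>.\<close>
    have eq: "\<phi> (g (s + Re w * \<epsilon>)) = w"
      unfolding g'(6)[OF u] \<phi>d using \<epsilon> wr by simp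
    moreover have "g (s + Re w * \<epsilon>) \<in> U"
      using eq w by (simp add: U_def)
    moreover have "g (s + Re w * \<epsilon>) \<in> path_image g"
      using g'(5)[OF u] by (simp add: path_image_def)
    ultimately show "w \<in> \<phi> ` (U \<inter> path_image g)" by force
  qed
  have imh: "\<phi> ` (U \<inter> path_image h) = {z \<in> ball 0 1. Re z = 0}"
  proof (intro equalityI subsetI)
    fix w assume "w \<in> \<phi> ` (U \<inter> path_image h)"
    then obtain z where z: "z \<in> U" "z \<in> path_image h" "w = \<phi> z" by auto
    then obtain x where "z = p + of_real x * d'" using U_ball h'(7) by auto
    then show "w \<in> {z \<in> ball 0 1. Re z = 0}"
      using z \<phi>d'[of x] by (auto simp: U_def)
  next
    fix w :: complex assume w: "w \<in> {z \<in> ball 0 1. Re z = 0}"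
    then have wr: "w = \<i> * of_real (Im w)" by (simp add: complex_eq_iff)
    then have "\<bar>Im w\<bar> < 1" using w abs_Im_le_cmod[of w] by auto
    then have "\<bar>Im w\<bar> * \<epsilon> < 1 * \<epsilon>"
      using \<epsilon>(1) by (intro mult_strict_right_mono)
    then have "\<bar>Im w * \<epsilon>\<bar> < \<eta>'"
      using \<epsilon>(2,3) unfolding abs_mult abs_of_pos[OF \<epsilon>(1)] by linarith
    then have u: "\<bar>(s' + Im w * \<epsilon>) - s'\<bar> < \<eta>'" by simp
    have eq: "\<phi> (h (s' + Im w * \<epsilon>)) = w"
      unfolding h'(6)[OF u] \<phi>d' using \<epsilon> wr by simp
    moreover have "h (s' + Im w * \<epsilon>) \<in> U"
      using eq w by (simp add: U_def)
    moreover have "h (s' + Im w * \<epsilon>) \<in> path_image h"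
      using h'(5)[OF u] by (simp add: path_image_def)
    ultimately show "w \<in> \<phi> ` (U \<inter> path_image h)" by force
  qed
  have chart: "cross_chart U \<phi> g h p"
    unfolding cross_chart_def using openU pU hom \<phi>p img imh by blast
  have "orientation_preserving_at U \<phi> p"
  proof -
    obtain r where r: "r > 0" "cball p r \<subseteq> U"
      using openU pU open_contains_cball by blast
    \<comment> \<open>The linear part of the chart, rewritten with \<open>z\<close> and
      \<open>cnj z\<close>, so that it maps circles to the ellipses treated above.\<close>
    define a where "a = (cnj d + \<i> * cnj d') / of_real (2 * \<epsilon> * D)"
    define b where "b = - (d + \<i> * d') / of_real (2 * \<epsilon> * D)"
    have "\<phi> (p + z) = a * z + b * cnj z" for z
      using \<epsilon> D by (simp add: \<phi>_def a_def b_def complex_eq_iff Re_divide_of_real Im_divide_of_real field_simps)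
    moreover have "circlepath p r t = p + circlepath 0 r t" for t
      by (simp add: circlepath)
    ultimately have "\<phi> \<circ> circlepath p r = (\<lambda>t. a * circlepath 0 r t + b * cnj (circlepath 0 r t))"
      by (auto simp: fun_eq_iff)
    moreover have "norm b < norm a"
    proof -
      \<comment> \<open>The two squares differ by exactly \<open>4 * D\<close>.\<close>
      have "(norm (- (d + \<i> * d')))\<^sup>2 < (norm (cnj d + \<i> * cnj d'))\<^sup>2"
        unfolding cmod_power2 using D by (simp add: D_def power2_eq_square algebra_simps)
      then have "norm (- (d + \<i> * d')) < norm (cnj d + \<i> * cnj d')"
        by (rule power_less_imp_less_base) simp
      then show ?thesis
        unfolding a_def b_def norm_divide using \<epsilon> D by (intro divide_strict_right_mono) auto
    qed
    ultimately show ?thesis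
      unfolding orientation_preserving_at_def using winding_number_ellipse r \<phi>p by metis
  qed
  moreover have "\<forall>\<^sub>F u in at_right s. 0 < Re (\<phi> (g u))"
    unfolding eventually_at_right_field
  proof (intro exI[of _ "s + \<eta>"] conjI allI impI)
    fix u assume "s < u" "u < s + \<eta>"
    then show "0 < Re (\<phi> (g u))"
      using \<epsilon> by (subst g'(6)) (simp_all only: \<phi>d, auto)
  qed (use g' in auto)
  moreover have "\<forall>\<^sub>F u in at_right s'. 0 < Im (\<phi> (h u))"
    unfolding eventually_at_right_field
  proof (intro exI[of _ "s' + \<eta>'"] conjI allI impI)
    fix u assume "s' < u" "u < s' + \<eta>'"
    then show "0 < Im (\<phi> (h u))"
      using \<epsilon> by (subst h'(6)) (simp_all only: \<phi>d', auto)
  qed (use h' in auto)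
  moreover have "g s = p" "h s' = p"
    using g'(6)[of s] h'(6)[of s'] g'(1) h'(1) by auto
  ultimately show ?thesis
    unfolding crosses_from_right_def using chart g'(3,4) h'(3,4)
    by (intro exI[of _ U] exI[of _ \<phi>] exI[of _ s] exI[of _ s']) simp
qed

text \<open>Reversing \<open>g\<close> replaces \<open>d\<close> by \<open>- d\<close> and so flips
  the sign of the determinant.\<close>

lemma crosses_from_left_if_locally_straight:
  assumes "arc g" "locally_straight g p d" "arc h" "locally_straight h p d'"
    and "Im (cnj d * d') < 0"
  shows "crosses_from_left g h p"
  unfolding crosses_from_left_def
  using assms locally_straight_reversepath[of g p d]
  by (intro crosses_from_right_if_locally_straight[where d = "- d" and d' = d'])
    (auto simp: arc_reversepath)

lemma crosses_at_if_locally_straight: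
  assumes "arc g" "locally_straight g p d" "arc h" "locally_straight h p d'"
    and "Im (cnj d * d') \<noteq> 0"
  shows "crosses_at g h p"
proof -
  consider "crosses_from_right g h p" | "crosses_from_left g h p"
    using assms crosses_from_right_if_locally_straight crosses_from_left_if_locally_straight
    by (metis linorder_neqE_linordered_idom)
  then show ?thesis
    by cases (auto simp: crosses_at_def crosses_from_left_def crosses_from_right_def cross_chart_def)
qed

text \<open>The sides of a triangle separate the interior of the hull, which is convex, from the
  outside, which is connected as the complement of a bounded convex set in the plane. A component of
  the complement contains whichever of the two it meets, so no Jordan curve theorem is
  involved.\<close>

lemma components_triangle_complement_meet:
  fixes a b c :: complex
  assumes C: "C \<in> components (- (closed_segment a b \<union> closed_segment b c \<union> closed_segment c a))"
    and x: "x \<in> convex hull {a, b, c}" "x \<notin> closed_segment a b \<union> closed_segment b c \<union> closed_segment c a"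
    and y: "y \<notin> convex hull {a, b, c}"
  shows "x \<in> C \<or> y \<in> C"
proof -
  let ?T = "closed_segment a b \<union> closed_segment b c \<union> closed_segment c a"
  let ?H = "convex hull {a, b, c}"
  have sub: "?T \<subseteq> ?H"
    by (simp add: segment_convex_hull hull_mono)
  have int: "interior ?H = ?H - ?T"
    by (rule interior_of_triangle) simp
  obtain z where z: "z \<in> C" "z \<notin> ?T"
    using C in_components_nonempty in_components_subset by blast
  show ?thesis
  proof (cases "z \<in> ?H")
    case True
    have "connected (?H - ?T)"
      by (metis int convex_connected convex_convex_hull convex_interior)
    then have "?H - ?T \<subseteq> C"
      using components_maximal[OF C, of "?H - ?T"] z True by blast
    with x show ?thesis by blast
  next
    case False
    have "connected (- ?H)"
      by (rule connected_complement_bounded_convex) (auto simp: bounded_convex_hull)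
    then have "- ?H \<subseteq> C"
      using components_maximal[OF C, of "- ?H"] z False sub by blast
    with y show ?thesis by blast
  qed
qed


section \<open>Straight and bent edges\<close>

definition straight_edge :: "real \<Rightarrow> real \<Rightarrow> real \<Rightarrow> real \<Rightarrow> complex" where
  "straight_edge \<sigma> \<tau> y = linepath (Complex \<sigma> \<tau>) (Complex 0 y)"

text \<open>The bend is twice the position of the other hub
  \<open>Complex \<sigma> (- \<tau>)\<close> of the same side, so the curve passes around that hub
  on the outside before it turns to the axis end at height \<open>- \<tau>\<close>.\<close>

definition bent_edge :: "real \<Rightarrow> real \<Rightarrow> real \<Rightarrow> complex" where
  "bent_edge \<sigma> \<tau> = linepath (Complex \<sigma> \<tau>) (Complex (2 * \<sigma>) (- 2 * \<tau>)) +++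
     linepath (Complex (2 * \<sigma>) (- 2 * \<tau>)) (Complex 0 (- \<tau>))"

lemma closed_segment_Complex:
  "z \<in> closed_segment (Complex a b) (Complex c d) \<longleftrightarrow>
   (\<exists>u\<ge>0. u \<le> 1 \<and> z = Complex ((1 - u) * a + u * c) ((1 - u) * b + u * d))"
  by (auto simp: in_segment complex_eq_iff)

lemma in_path_image_straight_edge:
  "z \<in> path_image (straight_edge \<sigma> \<tau> y) \<longleftrightarrow>
   (\<exists>u\<ge>0. u \<le> 1 \<and> z = Complex (\<sigma> * (1 - u)) (\<tau> * (1 - u) + y * u))"
  by (simp add: straight_edge_def closed_segment_Complex mult.commute)

lemma in_path_image_bent_edge:
  "z \<in> path_image (bent_edge \<sigma> \<tau>) \<longleftrightarrow>
   (\<exists>u\<ge>0. u \<le> 1 \<and> z = Complex (\<sigma> * (1 + u)) (\<tau> * (1 - 3 * u))) \<or>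
   (\<exists>u\<ge>0. u \<le> 1 \<and> z = Complex (\<sigma> * (2 - 2 * u)) (\<tau> * (u - 2)))"
proof -
  have "Complex ((1 - u) * \<sigma> + u * (2 * \<sigma>)) ((1 - u) * \<tau> + u * (- 2 * \<tau>)) =
      Complex (\<sigma> * (1 + u)) (\<tau> * (1 - 3 * u))"
    "Complex ((1 - u) * (2 * \<sigma>) + u * 0) ((1 - u) * (- 2 * \<tau>) + u * (- \<tau>)) =
      Complex (\<sigma> * (2 - 2 * u)) (\<tau> * (u - 2))" for u
    by (simp_all add: algebra_simps)
  moreover have "z \<in> path_image (bent_edge \<sigma> \<tau>) \<longleftrightarrow>
      z \<in> closed_segment (Complex \<sigma> \<tau>) (Complex (2 * \<sigma>) (- 2 * \<tau>)) \<or>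
      z \<in> closed_segment (Complex (2 * \<sigma>) (- 2 * \<tau>)) (Complex 0 (- \<tau>))"
    by (simp add: bent_edge_def path_image_join)
  ultimately show ?thesis
    by (simp only: closed_segment_Complex)
qed

section \<open>Incidences and crossings of straight and bent edges\<close>

text \<open>Stated as a disjunction, it lets automation split into the sign cases, in each of which
  the coordinates on an edge are affine in the curve parameter.\<close>

abbreviation unit_sign :: "real \<Rightarrow> bool" where
  "unit_sign x \<equiv> x = 1 \<or> x = -1"

lemma arc_straight_edge: "\<sigma> \<noteq> 0 \<Longrightarrow> arc (straight_edge \<sigma> \<tau> y)"
  by (simp add: straight_edge_def)

lemma arc_bent_edge:
  assumes "unit_sign \<sigma>" "unit_sign \<tau>"
  shows "arc (bent_edge \<sigma> \<tau>)"
  unfolding bent_edge_def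
proof (rule arc_join)
  show "path_image (linepath (Complex \<sigma> \<tau>) (Complex (2 * \<sigma>) (- 2 * \<tau>))) \<inter>
      path_image (linepath (Complex (2 * \<sigma>) (- 2 * \<tau>)) (Complex 0 (- \<tau>)))
      \<subseteq> {pathstart (linepath (Complex (2 * \<sigma>) (- 2 * \<tau>)) (Complex 0 (- \<tau>)))}"
    using assms by (auto simp: closed_segment_Complex)
qed (use assms in auto)

text \<open>Together with its analogue for bent edges, this confines every edge to the half-plane of
  its hub, so that edges of opposite sides can meet only at axis vertices.\<close>

lemma straight_edge_Re:
  assumes "unit_sign \<sigma>" "z \<in> path_image (straight_edge \<sigma> \<tau> y)"
  shows "0 \<le> \<sigma> * Re z" "Re z = 0 \<Longrightarrow> z = Complex 0 y"
  using assms by (auto simp: in_path_image_straight_edge)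

lemma bent_edge_Re:
  assumes "unit_sign \<sigma>" "unit_sign \<tau>" "z \<in> path_image (bent_edge \<sigma> \<tau>)"
  shows "0 \<le> \<sigma> * Re z" "Re z = 0 \<Longrightarrow> z = Complex 0 (- \<tau>)"
  using assms by (auto simp: in_path_image_bent_edge)

lemma straight_edge_hub:
  assumes "unit_sign \<sigma>" "unit_sign \<sigma>'" "Complex \<sigma>' \<tau>' \<in> path_image (straight_edge \<sigma> \<tau> y)"
  shows "\<sigma>' = \<sigma>" "\<tau>' = \<tau>"
  using assms by (auto simp: in_path_image_straight_edge)

lemma bent_edge_hub:
  assumes "unit_sign \<sigma>" "unit_sign \<sigma>'" "unit_sign \<tau>" "unit_sign \<tau>'"
    "Complex \<sigma>' \<tau>' \<in> path_image (bent_edge \<sigma> \<tau>)"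
  shows "\<sigma>' = \<sigma>" "\<tau>' = \<tau>"
  using assms by (auto simp: in_path_image_bent_edge)

lemma straight_edges_same_hub:
  assumes "unit_sign \<sigma>" "y \<noteq> y'"
    "z \<in> path_image (straight_edge \<sigma> \<tau> y)" "z \<in> path_image (straight_edge \<sigma> \<tau> y')"
  shows "z = Complex \<sigma> \<tau>"
  using assms by (auto simp: in_path_image_straight_edge)

text \<open>A straight edge satisfies \<open>\<sigma> * Re z \<le> 1\<close> and
  \<open>\<bar>Im z\<bar> \<le> 1\<close>. The first leg of a bent edge has
  \<open>\<sigma> * Re z \<ge> 1\<close>, which leaves only the hub of the straight edge; the second
  leg has \<open>\<bar>Im z\<bar> \<ge> 1\<close> with equality only on the axis.\<close>

lemma straight_bent_edge_meet:
  assumes "unit_sign \<sigma>" "unit_sign \<tau>" "unit_sign \<tau>'" "\<bar>y\<bar> \<le> 1"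
    and z: "z \<in> path_image (straight_edge \<sigma> \<tau> y)" "z \<in> path_image (bent_edge \<sigma> \<tau>')"
  shows "Re z = 0 \<or> z = Complex \<sigma> \<tau>"
proof -
  obtain u where u: "0 \<le> u" "u \<le> 1" "z = Complex (\<sigma> * (1 - u)) (\<tau> * (1 - u) + y * u)"
    using z(1) in_path_image_straight_edge by blast
  \<comment> \<open>Naming the product leaves only linear arithmetic, with
    \<open>\<bar>y\<bar> \<le> 1\<close> turned into bounds on \<open>w\<close>.\<close>
  define w where "w = y * u"
  have "w \<le> u" "- u \<le> w"
    unfolding w_def using assms(4) u mult_right_mono[of y 1 u] mult_right_mono[of "-1" y u] by auto
  with u(1,2) u(3)[folded w_def] z(2) assms(1-3) show ?thesis
    by (auto simp: in_path_image_bent_edge)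
qed

text \<open>Equal real parts force equal parameters on both segments, and equal imaginary parts then
  give a linear equation for the parameter. The closed form for \<open>z\<close> serves to show that
  the crossing is unique; the sign of the determinant does not depend on \<open>y\<close> and
  \<open>y'\<close>, which keeps all crossings of an edge on one orientation.\<close>

lemma straight_edges_cross:
  assumes "unit_sign \<sigma>" "unit_sign \<tau>" "\<bar>y\<bar> \<le> 1" "\<bar>y'\<bar> \<le> 1"
    and z: "z \<in> path_image (straight_edge \<sigma> \<tau> y)" "z \<in> path_image (straight_edge \<sigma> (- \<tau>) y')"
    and "Re z \<noteq> 0"
  shows "y \<noteq> y'" "z = linepath (Complex \<sigma> \<tau>) (Complex 0 y) (2 * \<tau> / (y' - y + 2 * \<tau>))"
    "\<exists>d d'. locally_straight (straight_edge \<sigma> \<tau> y) z d \<and>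
       locally_straight (straight_edge \<sigma> (- \<tau>) y') z d' \<and> \<sigma> * \<tau> * Im (cnj d * d') < 0"
proof -
  obtain u where u: "0 \<le> u" "u \<le> 1" "z = Complex (\<sigma> * (1 - u)) (\<tau> * (1 - u) + y * u)"
    using z(1) in_path_image_straight_edge by blast
  obtain u' where u': "z = Complex (\<sigma> * (1 - u')) (- \<tau> * (1 - u') + y' * u')"
    using z(2) in_path_image_straight_edge by blast
  have [simp]: "u' = u"
    using u(3) u' assms(1) by auto
  have "\<tau> * (1 - u) + y * u = - \<tau> * (1 - u) + y' * u"
    using u(3) u' by simp
  then have eq: "u * (y' - y + 2 * \<tau>) = 2 * \<tau>"
    by (simp add: algebra_simps)
  then have ne: "u \<noteq> 0" "y' - y + 2 * \<tau> \<noteq> 0"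
    using assms(2) by auto
  have "u \<noteq> 1"
    using u assms(7) by auto
  \<comment> \<open>Equal heights would make the equation read \<open>u = 1\<close>, a point on the
    axis.\<close>
  then show "y \<noteq> y'"
    using eq assms(2) by auto
  have lin: "linepath (Complex \<sigma> \<tau>) (Complex 0 y) u = z"
    "linepath (Complex \<sigma> (- \<tau>)) (Complex 0 y') u = z"
    using u(3) u' by (simp_all add: linepath_def complex_eq_iff algebra_simps)
  have "u = 2 * \<tau> / (y' - y + 2 * \<tau>)"
    using eq ne by (simp add: eq_divide_eq)
  with lin show "z = linepath (Complex \<sigma> \<tau>) (Complex 0 y) (2 * \<tau> / (y' - y + 2 * \<tau>))"
    by simp
  show "\<exists>d d'. locally_straight (straight_edge \<sigma> \<tau> y) z d \<and>
       locally_straight (straight_edge \<sigma> (- \<tau>) y') z d' \<and> \<sigma> * \<tau> * Im (cnj d * d') < 0"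
  proof (intro exI conjI)
    show "locally_straight (straight_edge \<sigma> \<tau> y) z (Complex 0 y - Complex \<sigma> \<tau>)"
      using locally_straight_linepath[of u] u ne(1) \<open>u \<noteq> 1\<close>
      unfolding straight_edge_def by (metis lin(1) order_less_le)
    show "locally_straight (straight_edge \<sigma> (- \<tau>) y') z (Complex 0 y' - Complex \<sigma> (- \<tau>))"
      using locally_straight_linepath[of u] u ne(1) \<open>u \<noteq> 1\<close>
      unfolding straight_edge_def by (metis lin(2) order_less_le)
    \<comment> \<open>The left-hand side equals \<open>- (2 + \<tau> * (y' - y))\<close>. This is at
      most 0 because both heights lie in \<open>[-1, 1]\<close>, and it is nonzero by
      \<open>ne(2)\<close>.\<close>
    show "\<sigma> * \<tau> * Im (cnj (Complex 0 y - Complex \<sigma> \<tau>) * (Complex 0 y' - Complex \<sigma> (- \<tau>))) < 0"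
      using assms(1-4) ne(2) by auto
  qed
qed

text \<open>The two curves are mirror images in the real axis. Only their first legs meet, at one
  third of their length, where they reach the real axis. The sign is opposite to that of straight
  edges, which is harmless since straight and bent edges never cross.\<close>

lemma bent_edges_cross:
  assumes "unit_sign \<sigma>" "unit_sign \<tau>"
    and z: "z \<in> path_image (bent_edge \<sigma> \<tau>)" "z \<in> path_image (bent_edge \<sigma> (- \<tau>))"
  shows "z = Complex (4 / 3 * \<sigma>) 0"
    "\<exists>d d'. locally_straight (bent_edge \<sigma> \<tau>) z d \<and>
       locally_straight (bent_edge \<sigma> (- \<tau>)) z d' \<and> 0 < \<sigma> * \<tau> * Im (cnj d * d')"
proof -
  show eq: "z = Complex (4 / 3 * \<sigma>) 0"
    using assms by (auto simp: in_path_image_bent_edge)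
  \<comment> \<open>The factor 2 comes from \<open>+++\<close>, which runs through the first leg at
    double speed.\<close>
  have "locally_straight (bent_edge \<sigma> t) z (2 * Complex \<sigma> (- 3 * t))" for t
  proof -
    have "linepath (Complex \<sigma> t) (Complex (2 * \<sigma>) (- 2 * t)) (1 / 3) = z"
      by (simp add: eq linepath_def complex_eq_iff)
    moreover have "Complex (2 * \<sigma>) (- 2 * t) - Complex \<sigma> t = Complex \<sigma> (- 3 * t)"
      by (simp add: complex_eq_iff)
    ultimately have "locally_straight (linepath (Complex \<sigma> t) (Complex (2 * \<sigma>) (- 2 * t))) z (Complex \<sigma> (- 3 * t))"
      using locally_straight_linepath[of "1 / 3" "Complex \<sigma> t" "Complex (2 * \<sigma>) (- 2 * t)"] by simp
    then show ?thesis
      unfolding bent_edge_def by (rule locally_straight_joinpaths1)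
  qed
  moreover have "0 < \<sigma> * \<tau> * Im (cnj (2 * Complex \<sigma> (- 3 * \<tau>)) * (2 * Complex \<sigma> (- 3 * - \<tau>)))"
    using assms(1,2) by auto
  ultimately show "\<exists>d d'. locally_straight (bent_edge \<sigma> \<tau>) z d \<and>
       locally_straight (bent_edge \<sigma> (- \<tau>)) z d' \<and> 0 < \<sigma> * \<tau> * Im (cnj d * d')"
    by blast
qed

text \<open>The parallel edges form a triangle with the other hub of the side in its interior,
  whereas a hub across the axis lies outside. Each region therefore contains one of the two.\<close>

lemma parallel_edges_components:
  assumes "unit_sign \<sigma>" "unit_sign \<tau>"
    and C: "C \<in> components (- (path_image (straight_edge \<sigma> \<tau> (- \<tau>)) \<union> path_image (bent_edge \<sigma> \<tau>)))"
  shows "Complex \<sigma> (- \<tau>) \<in> C \<or> Complex (- \<sigma>) \<tau> \<in> C"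
proof (rule components_triangle_complement_meet)
  let ?a = "Complex \<sigma> \<tau>" and ?b = "Complex (2 * \<sigma>) (- 2 * \<tau>)" and ?c = "Complex 0 (- \<tau>)"
  have eq: "path_image (straight_edge \<sigma> \<tau> (- \<tau>)) \<union> path_image (bent_edge \<sigma> \<tau>) =
      closed_segment ?a ?b \<union> closed_segment ?b ?c \<union> closed_segment ?c ?a"
    by (auto simp: straight_edge_def bent_edge_def path_image_join closed_segment_commute)
  show "C \<in> components (- (closed_segment ?a ?b \<union> closed_segment ?b ?c \<union> closed_segment ?c ?a))"
    using C by (simp only: eq)
  show "Complex \<sigma> (- \<tau>) \<notin> closed_segment ?a ?b \<union> closed_segment ?b ?c \<union> closed_segment ?c ?a"
    using straight_edge_hub[of \<sigma> \<sigma> "- \<tau>" \<tau>] bent_edge_hub[of \<sigma> \<sigma> \<tau> "- \<tau>"] assms(1,2)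
    unfolding eq[symmetric] by auto
  \<comment> \<open>These are the barycentric coordinates of the other hub.\<close>
  have "Complex \<sigma> (- \<tau>) = (1 / 5) *\<^sub>R ?a + (2 / 5) *\<^sub>R ?b + (2 / 5) *\<^sub>R ?c"
    by (simp add: complex_eq_iff)
  then show "Complex \<sigma> (- \<tau>) \<in> convex hull {?a, ?b, ?c}"
    unfolding convex_hull_3
    by (intro CollectI exI[of _ "1 / 5"] exI[of _ "2 / 5"]) auto
  have "convex {z. 0 \<le> \<sigma> * Re z}"
    by (rule convexI) (use assms in \<open>auto simp: algebra_simps intro: add_nonneg_nonneg\<close>)
  then have "convex hull {?a, ?b, ?c} \<subseteq> {z. 0 \<le> \<sigma> * Re z}"
    using assms by (intro hull_minimal) auto
  then show "Complex (- \<sigma>) \<tau> \<notin> convex hull {?a, ?b, ?c}"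
    using assms by auto
qed


section \<open>The graphs and their drawing\<close>

text \<open>Like \<open>level\<close>, this depends only on the residue modulo 4, so it applies to a
  hub and equally to an edge number, where it gives the sign of the hub of that edge.\<close>

definition side :: "nat \<Rightarrow> real" where
  "side h = (if even h then 1 else -1)"

definition level :: "nat \<Rightarrow> real" where
  "level h = (if h mod 4 < 2 then 1 else -1)"

definition height :: "nat \<Rightarrow> nat \<Rightarrow> real" where
  "height k i = 2 * real i / real k - 1"

text \<open>The vertices \<open>0, \<dots>, 3\<close> are the hubs and \<open>4, \<dots>, k + 4\<close> the vertices on the imaginary axis.
  Edge \<open>e\<close> starts at the hub \<open>e mod 4\<close>; it is straight and leads to the axis vertex number
  \<open>e div 4\<close> if \<open>e div 4 \<le> k\<close>, and it is the bent edge of its hub if \<open>e div 4 = k + 1\<close>.\<close>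

definition vertex_pos :: "nat \<Rightarrow> nat \<Rightarrow> complex" where
  "vertex_pos k v = (if v < 4 then Complex (side v) (level v) else Complex 0 (height k (v - 4)))"

text \<open>The axis indices 0 and \<open>k\<close> have the heights -1 and 1, so a bent edge ends
  at the height opposite to its hub.\<close>

definition axis_end :: "nat \<Rightarrow> nat \<Rightarrow> nat" where
  "axis_end k e = (if e div 4 \<le> k then e div 4 else if level e = 1 then 0 else k)"

definition edge_curve :: "nat \<Rightarrow> nat \<Rightarrow> real \<Rightarrow> complex" where
  "edge_curve k e = (if e div 4 \<le> k then straight_edge (side e) (level e) (height k (e div 4))
     else bent_edge (side e) (level e))"

text \<open>The parameter \<open>n\<close> counts edges: \<open>n = 4 * (k + 1)\<close> gives
  exactly the straight edges, and \<open>n = 4 * (k + 2)\<close> adds the four bent ones.\<close>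

definition hub_graph :: "nat \<Rightarrow> nat \<Rightarrow> (nat, nat) multigraph" where
  "hub_graph k n = \<lparr>verts = {..<k + 5}, edges = {..<n}, ends = \<lambda>e. {e mod 4, 4 + axis_end k e}\<rparr>"

lemma hub_graph_simps [simp]:
  "verts (hub_graph k n) = {..<k + 5}" "edges (hub_graph k n) = {..<n}"
  "ends (hub_graph k n) e = {e mod 4, 4 + axis_end k e}"
  by (simp_all add: hub_graph_def)

lemma unit_sign_side_level [simp]: "unit_sign (side h)" "unit_sign (level h)"
  by (auto simp: side_def level_def)

lemma side_level_mod [simp]: "side (h mod 4) = side h" "level (h mod 4) = level h"
proof -
  have "even (h mod 4) \<longleftrightarrow> even h" by presburger
  then show "side (h mod 4) = side h" by (simp add: side_def)
qed (simp add: level_def)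

lemma mod_4_eqI:
  assumes "side e = side f" "level e = level f"
  shows "e mod 4 = f mod 4"
proof -
  have "even e = even f" "e mod 4 < 2 \<longleftrightarrow> f mod 4 < 2"
    using assms by (auto simp: side_def level_def split: if_splits)
  then show ?thesis by presburger
qed

text \<open>Used to name the other hub of the same side, from which all edges that cross a given
  edge emanate.\<close>

lemma level_add_2: "level (h + 2) = - level h" "side (h + 2) = side h"
proof -
  have "(h + 2) mod 4 < 2 \<longleftrightarrow> \<not> h mod 4 < 2" by presburger
  then show "level (h + 2) = - level h" by (simp add: level_def)
qed (simp add: side_def)

lemma axis_end_le: "axis_end k e \<le> k"
  by (simp add: axis_end_def)

lemma height_eq_iff: "k \<noteq> 0 \<Longrightarrow> height k i = height k j \<longleftrightarrow> i = j"
  by (simp add: height_def)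

lemma abs_height_le: "i \<le> k \<Longrightarrow> \<bar>height k i\<bar> \<le> 1"
  by (cases "k = 0") (auto simp: height_def abs_le_iff field_simps)

lemma height_axis_end_bent:
  assumes "k \<noteq> 0" "\<not> e div 4 \<le> k"
  shows "height k (axis_end k e) = - level e"
  using assms by (auto simp: axis_end_def height_def level_def)

lemma vertex_pos_hub: "vertex_pos k (e mod 4) = Complex (side e) (level e)"
  by (simp add: vertex_pos_def)

lemma vertex_pos_axis: "vertex_pos k (4 + i) = Complex 0 (height k i)"
  by (simp add: vertex_pos_def)

lemma inj_on_vertex_pos:
  assumes "k \<noteq> 0"
  shows "inj_on (vertex_pos k) S"
proof (rule inj_onI)
  fix v w assume eq: "vertex_pos k v = vertex_pos k w"
  consider "v < 4" "w < 4" | "v \<ge> 4" "w \<ge> 4" | "v < 4 \<longleftrightarrow> \<not> w < 4" by linarith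
  then show "v = w"
  proof cases
    case 1
    then show ?thesis
      using eq mod_4_eqI[of v w] by (simp add: vertex_pos_def)
  next
    case 2
    then show ?thesis
      using eq assms by (simp add: vertex_pos_def height_eq_iff)
  next
    case 3
    then show ?thesis
      using eq by (auto simp: vertex_pos_def side_def split: if_splits)
  qed
qed

section \<open>Incidences and crossings in the drawing\<close>

lemma arc_edge_curve: "arc (edge_curve k e)"
  by (auto simp: edge_curve_def arc_bent_edge side_def intro!: arc_straight_edge)

lemma edge_curve_start: "pathstart (edge_curve k e) = vertex_pos k (e mod 4)"
  by (simp add: edge_curve_def straight_edge_def bent_edge_def vertex_pos_hub)

lemma edge_curve_finish:
  assumes "k \<noteq> 0"
  shows "pathfinish (edge_curve k e) = vertex_pos k (4 + axis_end k e)"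
  using height_axis_end_bent[OF assms, of e] unfolding vertex_pos_axis
  by (auto simp: edge_curve_def straight_edge_def bent_edge_def axis_end_def)

lemma edge_curve_Re:
  assumes "k \<noteq> 0" "z \<in> path_image (edge_curve k e)"
  shows "0 \<le> side e * Re z" "Re z = 0 \<Longrightarrow> z = vertex_pos k (4 + axis_end k e)"
proof -
  show "0 \<le> side e * Re z"
    using assms(2) straight_edge_Re(1)[of "side e" z "level e"] bent_edge_Re(1)[of "side e" "level e" z]
    by (auto simp: edge_curve_def split: if_splits)
  assume "Re z = 0"
  then show "z = vertex_pos k (4 + axis_end k e)"
    using assms(2) straight_edge_Re(2)[of "side e" z "level e"] bent_edge_Re(2)[of "side e" "level e" z]
      height_axis_end_bent[OF assms(1), of e] unfolding vertex_pos_axis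
    by (auto simp: edge_curve_def axis_end_def split: if_splits)
qed

lemma edge_curve_vertices:
  assumes "k \<noteq> 0" "vertex_pos k v \<in> path_image (edge_curve k e)"
  shows "v = e mod 4 \<or> v = 4 + axis_end k e"
proof (cases "v < 4")
  case True
  then have "Complex (side v) (level v) \<in> path_image (edge_curve k e)"
    using assms(2) by (simp add: vertex_pos_def)
  then have "side v = side e \<and> level v = level e"
    using straight_edge_hub[of "side e" "side v" "level v" "level e"]
      bent_edge_hub[of "side e" "side v" "level e" "level v"]
    by (auto simp: edge_curve_def split: if_splits)
  then show ?thesis
    using mod_4_eqI[of v e] True by simp
next
  case False
  then have "Re (vertex_pos k v) = 0" by (simp add: vertex_pos_def)
  then have "vertex_pos k v = vertex_pos k (4 + axis_end k e)"
    using edge_curve_Re(2)[OF assms] by blast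
  then show ?thesis
    using inj_on_vertex_pos[OF assms(1), of UNIV] by (simp add: inj_on_def)
qed

text \<open>Edges of opposite sides meet only on the axis, a straight and a bent edge only on the
  axis or at a hub, and straight edges of one hub only at that hub. What remains are edges of the
  same kind from the two hubs of one side.\<close>

lemma edge_curves_meet:
  assumes k: "k \<noteq> 0" and e: "e < 4 * (k + 2)" "f < 4 * (k + 2)" "e \<noteq> f"
    and z: "z \<in> path_image (edge_curve k e)" "z \<in> path_image (edge_curve k f)"
      "z \<notin> vertex_pos k ` {..<k + 5}"
  shows "Re z \<noteq> 0" "side f = side e" "level f = - level e" "e div 4 \<le> k \<longleftrightarrow> f div 4 \<le> k"
proof -
  have "4 + axis_end k e < k + 5"
    using axis_end_le[of k e] by simp
  then show nz: "Re z \<noteq> 0"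
    using edge_curve_Re(2)[OF k z(1)] z(3) by blast
  have hub: "z \<noteq> Complex (side h) (level h)" for h
  proof
    assume "z = Complex (side h) (level h)"
    then have "z = vertex_pos k (h mod 4)" by (simp add: vertex_pos_hub)
    moreover have "h mod 4 < k + 5" by (rule less_le_trans[of _ 4]) auto
    ultimately show False using z(3) by blast
  qed
  show s: "side f = side e"
    using edge_curve_Re(1)[OF k z(1)] edge_curve_Re(1)[OF k z(2)] nz
    by (auto simp: side_def split: if_splits)
  show iff: "e div 4 \<le> k \<longleftrightarrow> f div 4 \<le> k"
  proof (rule ccontr)
    assume "\<not> ?thesis"
    then consider "e div 4 \<le> k" "\<not> f div 4 \<le> k" | "f div 4 \<le> k" "\<not> e div 4 \<le> k" by blast
    then show False
    proof cases
      case 1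
      then show False
        using straight_bent_edge_meet[of "side e" "level e" "level f" "height k (e div 4)" z]
          z s nz hub[of e] abs_height_le[of "e div 4" k] by (simp add: edge_curve_def)
    next
      case 2
      then show False
        using straight_bent_edge_meet[of "side f" "level f" "level e" "height k (f div 4)" z]
          z s nz hub[of f] abs_height_le[of "f div 4" k] by (simp add: edge_curve_def)
    qed
  qed
  show "level f = - level e"
  proof (rule ccontr)
    assume "level f \<noteq> - level e"
    then have l: "level f = level e"
      by (auto simp: level_def split: if_splits)
    with s have m: "f mod 4 = e mod 4" by (rule mod_4_eqI)
    then have d: "e div 4 \<noteq> f div 4"
      using e(3) by (metis div_mult_mod_eq)
    \<comment> \<open>A bent edge has quotient \<open>k + 1\<close>, so each hub has only one. Two
      distinct edges of the same hub and kind are therefore straight.\<close>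
    moreover have "e div 4 < k + 2" "f div 4 < k + 2"
      using e(1,2) by (simp_all add: less_mult_imp_div_less mult.commute)
    ultimately have le: "e div 4 \<le> k" "f div 4 \<le> k"
      using iff by auto
    have "z = Complex (side e) (level e)"
      using straight_edges_same_hub[of "side e" "height k (e div 4)" "height k (f div 4)" z "level e"]
        z s l d le height_eq_iff[OF k] by (simp add: edge_curve_def)
    with hub show False by blast
  qed
qed

text \<open>The three facts serve in turn to show that adjacent edges do not cross, that two edges
  cross at most once, and that every crossing on \<open>e\<close> has an orientation determined by
  \<open>e\<close> alone.\<close>

lemma edge_curves_cross:
  assumes k: "k \<noteq> 0" and e: "e < 4 * (k + 2)" "f < 4 * (k + 2)" "e \<noteq> f"
    and z: "z \<in> path_image (edge_curve k e)" "z \<in> path_image (edge_curve k f)"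
      "z \<notin> vertex_pos k ` {..<k + 5}"
  shows "axis_end k e \<noteq> axis_end k f"
    "z = (if e div 4 \<le> k then linepath (Complex (side e) (level e)) (Complex 0 (height k (e div 4)))
            (2 * level e / (height k (f div 4) - height k (e div 4) + 2 * level e))
          else Complex (4 / 3 * side e) 0)"
    "\<exists>d d'. locally_straight (edge_curve k e) z d \<and> locally_straight (edge_curve k f) z d' \<and>
       (if e div 4 \<le> k then side e * level e * Im (cnj d * d') < 0
        else 0 < side e * level e * Im (cnj d * d'))"
proof -
  note m = edge_curves_meet[OF assms]
  have "axis_end k e \<noteq> axis_end k f \<and>
    z = (if e div 4 \<le> k then linepath (Complex (side e) (level e)) (Complex 0 (height k (e div 4)))
            (2 * level e / (height k (f div 4) - height k (e div 4) + 2 * level e))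
          else Complex (4 / 3 * side e) 0) \<and>
    (\<exists>d d'. locally_straight (edge_curve k e) z d \<and> locally_straight (edge_curve k f) z d' \<and>
       (if e div 4 \<le> k then side e * level e * Im (cnj d * d') < 0
        else 0 < side e * level e * Im (cnj d * d')))"
  proof (cases "e div 4 \<le> k")
    case True
    then have c: "edge_curve k e = straight_edge (side e) (level e) (height k (e div 4))"
      "edge_curve k f = straight_edge (side e) (- level e) (height k (f div 4))"
      using m by (simp_all add: edge_curve_def)
    have h: "\<bar>height k (e div 4)\<bar> \<le> 1" "\<bar>height k (f div 4)\<bar> \<le> 1"
      using True m(4) by (simp_all add: abs_height_le)
    note cr = straight_edges_cross[OF unit_sign_side_level h z(1)[unfolded c] z(2)[unfolded c] m(1)]
    have "axis_end k e \<noteq> axis_end k f"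
      using cr(1) True m(4) by (auto simp: axis_end_def)
    then show ?thesis
      unfolding c if_P[OF True] by (intro conjI cr(2,3))
  next
    case False
    then have c: "edge_curve k e = bent_edge (side e) (level e)"
      "edge_curve k f = bent_edge (side e) (- level e)"
      using m by (simp_all add: edge_curve_def)
    have "axis_end k e \<noteq> axis_end k f"
      \<comment> \<open>Bent edges of opposite levels end at the indices 0 and \<open>k\<close>,
        which differ since \<open>k\<close> is not 0.\<close>
      using False m(3,4) k by (auto simp: axis_end_def level_def split: if_splits)
    then show ?thesis
      unfolding c if_not_P[OF False]
      by (intro conjI bent_edges_cross[OF unit_sign_side_level z(1)[unfolded c] z(2)[unfolded c]])
  qed
  then show "axis_end k e \<noteq> axis_end k f"
    "z = (if e div 4 \<le> k then linepath (Complex (side e) (level e)) (Complex 0 (height k (e div 4)))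
            (2 * level e / (height k (f div 4) - height k (e div 4) + 2 * level e))
          else Complex (4 / 3 * side e) 0)"
    "\<exists>d d'. locally_straight (edge_curve k e) z d \<and> locally_straight (edge_curve k f) z d' \<and>
       (if e div 4 \<le> k then side e * level e * Im (cnj d * d') < 0
        else 0 < side e * level e * Im (cnj d * d'))"
    by blast+
qed

lemma in_crossings_hub_graph:
  "z \<in> crossings (hub_graph k n) (vertex_pos k) (edge_curve k) e f \<longleftrightarrow>
   z \<in> path_image (edge_curve k e) \<and> z \<in> path_image (edge_curve k f) \<and> z \<notin> vertex_pos k ` {..<k + 5}"
  by (auto simp: crossings_def)

lemma topological_drawing_hub_graph:
  assumes k: "k \<noteq> 0"
  shows "topological_drawing (hub_graph k (4 * (k + 2))) (vertex_pos k) (edge_curve k)"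
  unfolding topological_drawing_def
proof (intro conjI ballI impI)
  let ?G = "hub_graph k (4 * (k + 2))"
  show "inj_on (vertex_pos k) (verts ?G)"
    using inj_on_vertex_pos[OF k] .
  fix e assume e: "e \<in> edges ?G"
  show "arc (edge_curve k e)" by (rule arc_edge_curve)
  show endpts: "{pathstart (edge_curve k e), pathfinish (edge_curve k e)} = vertex_pos k ` ends ?G e"
    by (simp add: edge_curve_start edge_curve_finish[OF k])
  have "ends ?G e \<subseteq> verts ?G"
    using axis_end_le[of k e] by (auto intro: less_le_trans[of _ 4])
  moreover have "vertex_pos k ` ends ?G e \<subseteq> path_image (edge_curve k e)"
    unfolding endpts[symmetric] by auto
  moreover have "v \<in> ends ?G e" if "vertex_pos k v \<in> path_image (edge_curve k e)" for v
    using edge_curve_vertices[OF k that] by simp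
  ultimately show "path_image (edge_curve k e) \<inter> vertex_pos k ` verts ?G = vertex_pos k ` ends ?G e"
    by blast
  fix f assume f: "f \<in> edges ?G" and "e \<noteq> f"
  then have ef: "e < 4 * (k + 2)" "f < 4 * (k + 2)" "e \<noteq> f"
    using e by auto
  note cross = edge_curves_cross[OF k ef] and meet = edge_curves_meet[OF k ef]
  show "crossings ?G (vertex_pos k) (edge_curve k) e f = {}" if "ends ?G e \<inter> ends ?G f \<noteq> {}"
  proof (rule ccontr)
    assume "crossings ?G (vertex_pos k) (edge_curve k) e f \<noteq> {}"
    then obtain z where z: "z \<in> path_image (edge_curve k e)" "z \<in> path_image (edge_curve k f)"
      "z \<notin> vertex_pos k ` {..<k + 5}"
      by (auto simp: in_crossings_hub_graph)
    \<comment> \<open>Crossing edges have different hubs because their levels differ, and different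
      axis ends. A hub number is below 4 and an axis number is not, so no end is shared.\<close>
    have "level e \<noteq> level f"
      using meet(3)[OF z] by (auto simp: level_def split: if_splits)
    then have "e mod 4 \<noteq> f mod 4"
      using side_level_mod(2) by metis
    moreover have "e mod 4 < 4" "f mod 4 < 4" by simp_all
    ultimately show False
      using that cross(1)[OF z] by auto
  qed
  fix p assume "p \<in> crossings ?G (vertex_pos k) (edge_curve k) e f"
  then have p: "p \<in> path_image (edge_curve k e)" "p \<in> path_image (edge_curve k f)"
      "p \<notin> vertex_pos k ` {..<k + 5}"
    by (auto simp: in_crossings_hub_graph)
  obtain d d' where d: "locally_straight (edge_curve k e) p d" "locally_straight (edge_curve k f) p d'"
    and sign: "if e div 4 \<le> k then side e * level e * Im (cnj d * d') < 0
        else 0 < side e * level e * Im (cnj d * d')"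
    using cross(3)[OF p] by blast
  have "Im (cnj d * d') \<noteq> 0"
  proof
    assume zero: "Im (cnj d * d') = 0"
    show False
      using sign unfolding zero by (simp split: if_splits)
  qed
  then show "crosses_at (edge_curve k e) (edge_curve k f) p"
    by (rule crosses_at_if_locally_straight[OF arc_edge_curve d(1) arc_edge_curve d(2)])
  fix q assume "q \<in> crossings ?G (vertex_pos k) (edge_curve k) e f"
  then have q: "q \<in> path_image (edge_curve k e)" "q \<in> path_image (edge_curve k f)"
      "q \<notin> vertex_pos k ` {..<k + 5}"
    by (auto simp: in_crossings_hub_graph)
  \<comment> \<open>Both points equal one closed expression in \<open>e\<close> and
    \<open>f\<close>.\<close>
  show "p = q"
    by (rule trans[OF cross(2)[OF p] cross(2)[OF q, symmetric]])
qed

text \<open>Two distinct parallel edges share their hub, and one of them is straight and the other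
  bent, so they form the triangle around the other hub of that side.\<close>

lemma no_homotopic_edges_hub_graph:
  assumes k: "k \<noteq> 0"
  shows "no_homotopic_edges (hub_graph k (4 * (k + 2))) (vertex_pos k) (edge_curve k)"
proof -
  let ?G = "hub_graph k (4 * (k + 2))"
  have main: "\<exists>v\<in>verts ?G. vertex_pos k v \<in> C"
    if e: "e div 4 \<le> k" "\<not> f div 4 \<le> k" "side e = side f" "level e = level f" "axis_end k e = axis_end k f"
      and C: "C \<in> components (- (path_image (edge_curve k e) \<union> path_image (edge_curve k f)))"
    for e f C
  proof -
    have "height k (e div 4) = - level e"
      using height_axis_end_bent[OF k e(2)] e by (simp add: axis_end_def)
    then have "Complex (side e) (- level e) \<in> C \<or> Complex (- side e) (level e) \<in> C"
      using parallel_edges_components[of "side e" "level e" C] C e by (simp add: edge_curve_def)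
    moreover have "Complex (side e) (- level e) = vertex_pos k ((e + 2) mod 4)"
      by (simp only: vertex_pos_hub level_add_2)
    \<comment> \<open>The hub at the same level across the axis, which lies outside the triangle: 0
      and 1 are partners, and so are 2 and 3.\<close>
    moreover obtain h where "side h = - side e" "level h = level e" "h < 4"
    proof -
      have "e mod 4 = 0 \<or> e mod 4 = 1 \<or> e mod 4 = 2 \<or> e mod 4 = 3" by presburger
      then show thesis
      proof (elim disjE)
        assume "e mod 4 = 0"
        moreover from this have "even e" by presburger
        ultimately show thesis by (intro that[of 1]) (simp_all add: side_def level_def)
      next
        assume "e mod 4 = 1"
        moreover from this have "odd e" by presburger
        ultimately show thesis by (intro that[of 0]) (simp_all add: side_def level_def)
      next
        assume "e mod 4 = 2"
        moreover from this have "even e" by presburger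
        ultimately show thesis by (intro that[of 3]) (simp_all add: side_def level_def)
      next
        assume "e mod 4 = 3"
        moreover from this have "odd e" by presburger
        ultimately show thesis by (intro that[of 2]) (simp_all add: side_def level_def)
      qed
    qed
    then have "Complex (- side e) (level e) = vertex_pos k h" "h \<in> verts ?G"
      by (simp_all add: vertex_pos_def)
    moreover have "(e + 2) mod 4 \<in> verts ?G"
      using mod_less_divisor[of 4 "e + 2"] unfolding hub_graph_simps lessThan_iff by linarith
    ultimately show ?thesis by auto
  qed
  show ?thesis
    unfolding no_homotopic_edges_def
  proof (intro ballI impI, elim conjE)
    fix e f C
    assume ef: "e \<in> edges ?G" "f \<in> edges ?G" "e \<noteq> f" and ends: "ends ?G e = ends ?G f"
      and C: "C \<in> components (- (path_image (edge_curve k e) \<union> path_image (edge_curve k f)))"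
    have lt: "e mod 4 < 4" "f mod 4 < 4" by simp_all
    then have m: "e mod 4 = f mod 4" and a: "axis_end k e = axis_end k f"
      using ends by (auto simp: doubleton_eq_iff)
    from m have sl: "side e = side f" "level e = level f"
      using side_level_mod by metis+
    have "e div 4 \<noteq> f div 4"
      using ef(3) m by (metis div_mult_mod_eq)
    moreover have "e div 4 < k + 2" "f div 4 < k + 2"
      using ef(1,2) by (simp_all add: less_mult_imp_div_less mult.commute)
    \<comment> \<open>Two straight edges with equal axis ends would have equal quotients, and two
      bent edges would both have quotient \<open>k + 1\<close>.\<close>
    ultimately consider "e div 4 \<le> k" "\<not> f div 4 \<le> k" | "f div 4 \<le> k" "\<not> e div 4 \<le> k"
      using a by (auto simp: axis_end_def split: if_splits)
    then show "\<exists>v\<in>verts ?G. vertex_pos k v \<in> C"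
    proof cases
      case 1
      then show ?thesis using main[OF 1 sl a C] by blast
    next
      case 2
      then show ?thesis
        using main[OF 2 sl[symmetric] a[symmetric]] C by (metis Un_commute)
    qed
  qed
qed

section \<open>Fan-planarity\<close>

proposition fan_planar_drawing_hub_graph:
  assumes k: "k \<noteq> 0"
  shows "fan_planar_drawing (hub_graph k (4 * (k + 2))) (vertex_pos k) (edge_curve k)"
  unfolding fan_planar_drawing_def
proof (intro conjI ballI topological_drawing_hub_graph no_homotopic_edges_hub_graph k)
  let ?G = "hub_graph k (4 * (k + 2))"
  let ?X = "crossings ?G (vertex_pos k) (edge_curve k)"
  fix e assume e: "e \<in> edges ?G"
  \<comment> \<open>The common endpoint is the other hub on the side of \<open>e\<close>.\<close>
  define v where "v = (e + 2) mod 4"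
  have hub: "f mod 4 = v" if "f \<in> edges ?G" "f \<noteq> e" "z \<in> ?X e f" for f z
  proof -
    have "side f = side (e + 2)" "level f = level (e + 2)"
      unfolding level_add_2 using edge_curves_meet(2,3)[OF k, of e f z] that e
      by (auto simp: in_crossings_hub_graph)
    then show ?thesis
      unfolding v_def by (rule mod_4_eqI)
  qed
  \<comment> \<open>Edge curves start at their hubs, so those leaving \<open>v\<close> need no
    reversal.\<close>
  have dir: "directed_from (vertex_pos k v) (edge_curve k f) = edge_curve k f" if "f mod 4 = v" for f
    using that by (simp add: directed_from_def edge_curve_start)
  have chart: "\<exists>d d'. locally_straight (edge_curve k e) z d \<and> locally_straight (edge_curve k f) z d' \<and>
       (if e div 4 \<le> k then side e * level e * Im (cnj d * d') < 0
        else 0 < side e * level e * Im (cnj d * d'))"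
    if "f \<in> edges ?G" "f \<noteq> e" "z \<in> ?X e f" for f z
    using edge_curves_cross(3)[OF k, of e f z] that e by (auto simp: in_crossings_hub_graph)
  have "side e * level e = 1 \<or> side e * level e = -1"
    by (auto simp: side_def level_def)
  \<comment> \<open>For fixed \<open>e\<close>, both its kind and the sign of
    \<open>side e * level e\<close> are fixed, so all determinants at its crossings have the same
    sign.\<close>
  then consider
    "\<And>x. (if e div 4 \<le> k then side e * level e * x < 0 else 0 < side e * level e * x) \<Longrightarrow> 0 < x"
    | "\<And>x. (if e div 4 \<le> k then side e * level e * x < 0 else 0 < side e * level e * x) \<Longrightarrow> x < 0"
    by (cases "e div 4 \<le> k") auto
  then have "(\<forall>f\<in>edges ?G. f \<noteq> e \<longrightarrow> (\<forall>p\<in>?X e f.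
      crosses_from_right (edge_curve k e) (directed_from (vertex_pos k v) (edge_curve k f)) p)) \<or>
    (\<forall>f\<in>edges ?G. f \<noteq> e \<longrightarrow> (\<forall>p\<in>?X e f.
      crosses_from_left (edge_curve k e) (directed_from (vertex_pos k v) (edge_curve k f)) p))"
  proof cases
    case 1
    then have "crosses_from_right (edge_curve k e) (edge_curve k f) p"
      if "f \<in> edges ?G" "f \<noteq> e" "p \<in> ?X e f" for f p
      using chart[OF that] crosses_from_right_if_locally_straight[OF arc_edge_curve _ arc_edge_curve]
      by blast
    with hub dir show ?thesis by metis
  next
    case 2
    then have "crosses_from_left (edge_curve k e) (edge_curve k f) p"
      if "f \<in> edges ?G" "f \<noteq> e" "p \<in> ?X e f" for f p
      using chart[OF that] crosses_from_left_if_locally_straight[OF arc_edge_curve _ arc_edge_curve]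
      by blast
    with hub dir show ?thesis by metis
  qed
  moreover have "\<forall>f\<in>edges ?G. f \<noteq> e \<and> ?X e f \<noteq> {} \<longrightarrow> v \<in> ends ?G f"
    using hub by (metis all_not_in_conv hub_graph_simps(3) insertI1)
  ultimately show "\<exists>v. (\<forall>f\<in>edges ?G. f \<noteq> e \<and> ?X e f \<noteq> {} \<longrightarrow> v \<in> ends ?G f) \<and>
      ((\<forall>f\<in>edges ?G. f \<noteq> e \<longrightarrow> (\<forall>p\<in>?X e f.
          crosses_from_right (edge_curve k e) (directed_from (vertex_pos k v) (edge_curve k f)) p)) \<or>
       (\<forall>f\<in>edges ?G. f \<noteq> e \<longrightarrow> (\<forall>p\<in>?X e f.
          crosses_from_left (edge_curve k e) (directed_from (vertex_pos k v) (edge_curve k f)) p)))"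
    by blast
qed

text \<open>The conditions range universally over edges, and the witness \<open>v\<close> of an edge
  remains valid for fewer crossing edges. Keeping all vertices preserves the sets of crossings and
  the vertices inside the regions.\<close>

lemma fan_planar_drawing_delete_edges:
  assumes D: "fan_planar_drawing G pos \<gamma>"
    and H: "verts H = verts G" "edges H \<subseteq> edges G" "ends H = ends G"
  shows "fan_planar_drawing H pos \<gamma>"
proof -
  have X: "crossings H pos \<gamma> = crossings G pos \<gamma>"
    by (simp add: crossings_def fun_eq_iff H)
  have T: "topological_drawing G pos \<gamma>" and N: "no_homotopic_edges G pos \<gamma>"
    using D unfolding fan_planar_drawing_def by blast+
  have "topological_drawing H pos \<gamma>"
    unfolding topological_drawing_def X H(1,3)
  proof (intro conjI)
    note T' = T[unfolded topological_drawing_def]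
    show "inj_on pos (verts G)"
      using T' by (rule conjunct1)
    show "\<forall>e\<in>edges H. arc (\<gamma> e) \<and> {pathstart (\<gamma> e), pathfinish (\<gamma> e)} = pos ` ends G e \<and>
        path_image (\<gamma> e) \<inter> pos ` verts G = pos ` ends G e"
      by (intro ballI bspec[OF T'[THEN conjunct2, THEN conjunct1]] subsetD[OF H(2)])
    show "\<forall>e\<in>edges H. \<forall>f\<in>edges H. e \<noteq> f \<longrightarrow>
        (ends G e \<inter> ends G f \<noteq> {} \<longrightarrow> crossings G pos \<gamma> e f = {}) \<and>
        (\<forall>p\<in>crossings G pos \<gamma> e f. crosses_at (\<gamma> e) (\<gamma> f) p) \<and>
        (\<forall>p\<in>crossings G pos \<gamma> e f. \<forall>q\<in>crossings G pos \<gamma> e f. p = q)"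
      by (intro ballI bspec[OF bspec[OF T'[THEN conjunct2, THEN conjunct2]]] subsetD[OF H(2)])
  qed
  moreover have "no_homotopic_edges H pos \<gamma>"
    unfolding no_homotopic_edges_def H(1,3)
    by (intro ballI[of "edges H"] bspec[OF bspec[OF N[unfolded no_homotopic_edges_def]]] subsetD[OF H(2)])
  moreover have "\<exists>v. (\<forall>f\<in>edges H. f \<noteq> e \<and> crossings G pos \<gamma> e f \<noteq> {} \<longrightarrow> v \<in> ends G f) \<and>
        ((\<forall>f\<in>edges H. f \<noteq> e \<longrightarrow> (\<forall>p\<in>crossings G pos \<gamma> e f.
            crosses_from_right (\<gamma> e) (directed_from (pos v) (\<gamma> f)) p)) \<or>
         (\<forall>f\<in>edges H. f \<noteq> e \<longrightarrow> (\<forall>p\<in>crossings G pos \<gamma> e f.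
            crosses_from_left (\<gamma> e) (directed_from (pos v) (\<gamma> f)) p)))" if "e \<in> edges H" for e
  proof -
    note F = D[unfolded fan_planar_drawing_def, THEN conjunct2, THEN conjunct2]
    from bspec[OF F subsetD[OF H(2) that]] obtain v where
      v: "\<forall>f\<in>edges G. f \<noteq> e \<and> crossings G pos \<gamma> e f \<noteq> {} \<longrightarrow> v \<in> ends G f" and
      sides: "(\<forall>f\<in>edges G. f \<noteq> e \<longrightarrow> (\<forall>p\<in>crossings G pos \<gamma> e f.
            crosses_from_right (\<gamma> e) (directed_from (pos v) (\<gamma> f)) p)) \<or>
         (\<forall>f\<in>edges G. f \<noteq> e \<longrightarrow> (\<forall>p\<in>crossings G pos \<gamma> e f.
            crosses_from_left (\<gamma> e) (directed_from (pos v) (\<gamma> f)) p))"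
      by (elim exE conjE)
    show ?thesis
    proof (intro exI[of _ v] conjI)
      show "\<forall>f\<in>edges H. f \<noteq> e \<and> crossings G pos \<gamma> e f \<noteq> {} \<longrightarrow> v \<in> ends G f"
        by (intro ballI bspec[OF v] subsetD[OF H(2)])
      show "(\<forall>f\<in>edges H. f \<noteq> e \<longrightarrow> (\<forall>p\<in>crossings G pos \<gamma> e f.
            crosses_from_right (\<gamma> e) (directed_from (pos v) (\<gamma> f)) p)) \<or>
         (\<forall>f\<in>edges H. f \<noteq> e \<longrightarrow> (\<forall>p\<in>crossings G pos \<gamma> e f.
            crosses_from_left (\<gamma> e) (directed_from (pos v) (\<gamma> f)) p))"
        using sides
      proof (elim disjE)
        assume R: "\<forall>f\<in>edges G. f \<noteq> e \<longrightarrow> (\<forall>p\<in>crossings G pos \<gamma> e f.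
            crosses_from_right (\<gamma> e) (directed_from (pos v) (\<gamma> f)) p)"
        show ?thesis
          by (intro disjI1 ballI[of "edges H"] bspec[OF R] subsetD[OF H(2)])
      next
        assume L: "\<forall>f\<in>edges G. f \<noteq> e \<longrightarrow> (\<forall>p\<in>crossings G pos \<gamma> e f.
            crosses_from_left (\<gamma> e) (directed_from (pos v) (\<gamma> f)) p)"
        show ?thesis
          by (intro disjI2 ballI[of "edges H"] bspec[OF L] subsetD[OF H(2)])
      qed
    qed
  qed
  ultimately show ?thesis
    unfolding fan_planar_drawing_def X H(1,3) by (intro conjI ballI)
qed

lemma fan_planar_hub_graph:
  assumes "k \<noteq> 0" "n \<le> 4 * (k + 2)"
  shows "fan_planar (hub_graph k n)"
  unfolding fan_planar_def
  using fan_planar_drawing_delete_edges[OF fan_planar_drawing_hub_graph[OF assms(1)], of "hub_graph k n"]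
    assms(2) by (fastforce simp: hub_graph_def)

section \<open>Combinatorial properties and the infinite families\<close>

lemma is_multigraph_hub_graph: "is_multigraph (hub_graph k n)"
proof -
  have "e mod 4 \<noteq> 4 + axis_end k e" "e mod 4 < k + 5" for e
    using mod_less_divisor[of 4 e] by linarith+
  then show ?thesis
    using axis_end_le[of k] by (auto simp: is_multigraph_def le_imp_less_Suc)
qed

lemma bipartite_hub_graph: "bipartite (hub_graph k n)"
  unfolding bipartite_def
proof (intro exI conjI ballI)
  fix e assume "e \<in> edges (hub_graph k n)"
  have "4 + axis_end k e \<in> {4..<k + 5}"
    using axis_end_le[of k e] by simp
  then show "\<exists>a\<in>{..<4}. \<exists>b\<in>{4..<k + 5}. ends (hub_graph k n) e = {a, b}"
    by (intro bexI[of _ "e mod 4"] bexI[of _ "4 + axis_end k e"]) auto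
qed auto

text \<open>Without bent edges, the hub and the axis end of an edge are its remainder and quotient
  by 4 and so determine it.\<close>

lemma is_simple_graph_hub_graph: "is_simple_graph (hub_graph k (4 * (k + 1)))"
  unfolding is_simple_graph_def
proof (intro conjI is_multigraph_hub_graph inj_onI)
  fix e f
  assume e: "e \<in> edges (hub_graph k (4 * (k + 1)))" and f: "f \<in> edges (hub_graph k (4 * (k + 1)))"
    and eq: "ends (hub_graph k (4 * (k + 1))) e = ends (hub_graph k (4 * (k + 1))) f"
  have "e div 4 \<le> k" "f div 4 \<le> k"
    using e f by auto
  moreover have "e mod 4 < 4" "f mod 4 < 4" by simp_all
  ultimately have "e mod 4 = f mod 4" "e div 4 = f div 4"
    using eq by (auto simp: doubleton_eq_iff axis_end_def)
  then show "e = f"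
    by (metis div_mult_mod_eq)
qed

lemma isomorphic_card_verts: "isomorphic G H \<Longrightarrow> card (verts G) = card (verts H)"
  unfolding isomorphic_def using bij_betw_same_card by blast

text \<open>Different \<open>k\<close> give different numbers \<open>k + 5\<close> of vertices. The
  edge count \<open>N\<close> is arbitrary so that one lemma serves both families.\<close>

lemma infinite_nonisomorphic_hub_graphs:
  defines "\<G> N \<equiv> (\<lambda>k. hub_graph k (N k)) ` {1..}"
  shows "infinite (\<G> N)" "pairwise (\<lambda>G H. \<not> isomorphic G H) (\<G> N)"
proof -
  have "inj_on (\<lambda>k. hub_graph k (N k)) {1..}"
    by (rule inj_onI) (auto dest: arg_cong[where f = "\<lambda>G. card (verts G)"])
  then show "infinite (\<G> N)"
    unfolding \<G>_def by (simp add: finite_image_iff infinite_Ici)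
  show "pairwise (\<lambda>G H. \<not> isomorphic G H) (\<G> N)"
    unfolding \<G>_def by (auto simp: pairwise_def dest!: isomorphic_card_verts)
qed

theorem theorem7:
  "(\<exists>\<G> :: (nat, nat) multigraph set.
      infinite \<G> \<and> pairwise (\<lambda>G H. \<not> isomorphic G H) \<G> \<and>
      (\<forall>G\<in>\<G>. is_simple_graph G \<and> bipartite G \<and> fan_planar G \<and>
         int (card (edges G)) = 4 * int (card (verts G)) - 16)) \<and>
   (\<exists>\<G> :: (nat, nat) multigraph set.
      infinite \<G> \<and> pairwise (\<lambda>G H. \<not> isomorphic G H) \<G> \<and>
      (\<forall>G\<in>\<G>. is_multigraph G \<and> bipartite G \<and> fan_planar G \<and>
         int (card (edges G)) = 4 * int (card (verts G)) - 12))"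
proof (intro conjI)
  show "\<exists>\<G> :: (nat, nat) multigraph set.
      infinite \<G> \<and> pairwise (\<lambda>G H. \<not> isomorphic G H) \<G> \<and>
      (\<forall>G\<in>\<G>. is_simple_graph G \<and> bipartite G \<and> fan_planar G \<and>
         int (card (edges G)) = 4 * int (card (verts G)) - 16)"
    \<comment> \<open>With \<open>k + 5\<close> vertices,
      \<open>4 * (k + 1) = 4 * (k + 5) - 16\<close>.\<close>
    by (intro exI[of _ "(\<lambda>k. hub_graph k (4 * (k + 1))) ` {1..}"] conjI ballI
        infinite_nonisomorphic_hub_graphs)
      (use is_simple_graph_hub_graph bipartite_hub_graph in \<open>auto intro!: fan_planar_hub_graph\<close>)
  show "\<exists>\<G> :: (nat, nat) multigraph set.
      infinite \<G> \<and> pairwise (\<lambda>G H. \<not> isomorphic G H) \<G> \<and>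
      (\<forall>G\<in>\<G>. is_multigraph G \<and> bipartite G \<and> fan_planar G \<and>
         int (card (edges G)) = 4 * int (card (verts G)) - 12)"
    \<comment> \<open>The four bent edges raise the count to
      \<open>4 * (k + 2) = 4 * (k + 5) - 12\<close>.\<close>
    by (intro exI[of _ "(\<lambda>k. hub_graph k (4 * (k + 2))) ` {1..}"] conjI ballI
        infinite_nonisomorphic_hub_graphs)
      (use is_multigraph_hub_graph bipartite_hub_graph in \<open>auto intro!: fan_planar_hub_graph\<close>)
qed

end
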